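(* Suppose the Gaussian-approximation condition (GA) of the context is satisfied (with preconditioning matrix $\tilde I$ and matrix $J$). For any compact set $K\subset\mathbb R^d$, the initial distribution $$\mu_0=N_d(\hat\theta,n^{-1}\tilde I)\big|_{\{\theta:\sqrt n(\theta-\hat\theta)\in K\}}$$ (the Gaussian conditioned on the indicated set) is $M$-warm with respect to $\pi_n$ for some $M$ satisfying $$\log M\le-\log\pi_n\big(\{\theta:\sqrt n(\theta-\hat\theta)\in K\}\big)+\sup_{\xi\in K}\big|\xi^T(\tilde I^{-1}-J)\xi\big|+2\sup_{\xi\in K}\big|V_n(\xi)-\tfrac12\xi^TJ\xi\big|.$$
   Context: Setting. $\Theta\subset\mathbb R^d$, $\pi$ is a prior density on $\Theta$, $\mathcal C_n$ is a real-valued (data-dependent) criterion function on $\Theta$; $\pi_n(\theta)\propto\exp\{\log\pi(\theta)+\mathcal C_n(\theta)\}$ is a probability density on $\Theta$ (zero outside); $\hat\theta=\arg\max_\Theta\mathcal C_n$; and $V_n(\xi)=-\mathcal C_n(\hat\theta+\xi/\sqrt n)+\mathcal C_n(\hat\theta)-\log\pi(\hat\theta+\xi/\sqrt n)+\log\pi(\hat\theta)$, so $\pi_n(\theta)\propto\exp\{-V_n(\sqrt n(\theta-\hat\theta))\}$. $\tilde\nabla V_n$ is a choice of subgradient of $V_n$ (a subgradient of $f$ at $x$ is $g$ with $f(y)\ge f(x)+\langle g,y-x\rangle+o(\|y-x\|)$). Condition (GA): there exist $\varepsilon\in(0,1)$, symmetric positive definite $\tilde I$, $h>0$, $M_0$,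 $R,\tilde\varepsilon_0,\tilde\varepsilon_1\ge0$, $\rho_1,\rho_2>0$ and symmetric positive definite $J\in\mathbb R^{d\times d}$ such that (1) for every $\xi$ with $\|\tilde I^{-1/2}\xi\|\le R$: $|V_n(\xi)-\tfrac12\xi^TJ\xi|\le\tilde\varepsilon_0$ and $\|\tilde\nabla V_n(\xi)-J\xi\|\le\tilde\varepsilon_1$; (2) $\rho_1I_d\preceq\tilde J=\tilde I^{1/2}J\tilde I^{1/2}\preceq\rho_2I_d$; (3) $\pi_n(\sqrt n\|\tilde I^{-1/2}(\theta-\hat\theta)\|\le R/2)\ge1-\exp(-4\tilde\varepsilon_0)\frac{h\rho_1\varepsilon^2}{M_0^2}$ and $R\ge8\sqrt{d/\lambda_{\min}(\tilde J)}$. $\mu_0$ is $M$-warm with respect to $\mu$ if $\mu_0(E)\le M\mu(E)$ for every Borel set $E\subset\mathbb R^d$. *)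

theory Defs
  imports "HOL-Probability.Probability" "HOL-Library.Landau_Symbols"
begin

section \<open>Symmetric matrices\<close>

definition spd :: "real^'d^'d \<Rightarrow> bool" where
  "spd A \<longleftrightarrow> transpose A = A \<and> (\<forall>v. v \<noteq> 0 \<longrightarrow> 0 < v \<bullet> (A *v v))"

definition psd :: "real^'d^'d \<Rightarrow> bool" where
  "psd A \<longleftrightarrow> transpose A = A \<and> (\<forall>v. 0 \<le> v \<bullet> (A *v v))"

definition loewner_le :: "real^'d^'d \<Rightarrow> real^'d^'d \<Rightarrow> bool" where
  "loewner_le A B \<longleftrightarrow> psd (B - A)"

text \<open>Meaningful for symmetric positive definite \<open>A\<close>, for which the root is unique.\<close>

definition spd_sqrt :: "real^'d^'d \<Rightarrow> real^'d^'d" where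
  "spd_sqrt A = (THE S. spd S \<and> S ** S = A)"

definition eigenvalues :: "real^'d^'d \<Rightarrow> real set" where
  "eigenvalues A = {l. \<exists>v. v \<noteq> 0 \<and> A *v v = l *\<^sub>R v}"

definition lambda_min :: "real^'d^'d \<Rightarrow> real" where
  "lambda_min A = Min (eigenvalues A)"

section \<open>The posterior and its potential\<close>

text \<open>The density is proportional to \<open>exp (ln (prior \<theta>) + C \<theta>)\<close> on \<open>\<Theta>\<close>, read as \<open>0\<close> where
  \<open>prior \<theta> = 0\<close>. If the normalizing integral is \<open>0\<close> or infinite, the result is not a
  probability measure.\<close>

definition posterior_unnorm :: "(real^'d) set \<Rightarrow> (real^'d \<Rightarrow> real) \<Rightarrow> (real^'d \<Rightarrow> real)
    \<Rightarrow> real^'d \<Rightarrow> ennreal" where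
  "posterior_unnorm \<Theta> prior C \<theta> = (if \<theta> \<in> \<Theta> then ennreal (prior \<theta> * exp (C \<theta>)) else 0)"

definition posterior :: "(real^'d) set \<Rightarrow> (real^'d \<Rightarrow> real) \<Rightarrow> (real^'d \<Rightarrow> real)
    \<Rightarrow> (real^'d) measure" where
  "posterior \<Theta> prior C =
     density lborel (\<lambda>\<theta>. posterior_unnorm \<Theta> prior C \<theta> /
                          (\<integral>\<^sup>+t. posterior_unnorm \<Theta> prior C t \<partial>lborel))"

text \<open>The potential takes the value \<open>\<infinity>\<close> exactly where the posterior density vanishes.\<close>

definition potential :: "(real^'d) set \<Rightarrow> (real^'d \<Rightarrow> real) \<Rightarrow> (real^'d \<Rightarrow> real) \<Rightarrow> nat
    \<Rightarrow> real^'d \<Rightarrow> real^'d \<Rightarrow> ereal" where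
  "potential \<Theta> prior C n \<theta>hat \<xi> =
     (let \<theta> = \<theta>hat + \<xi> /\<^sub>R sqrt (real n) in
      if \<theta> \<in> \<Theta> \<and> prior \<theta> > 0
      then ereal (- C \<theta> + C \<theta>hat - ln (prior \<theta>) + ln (prior \<theta>hat))
      else \<infinity>)"

definition is_subgradient :: "(real^'d \<Rightarrow> ereal) \<Rightarrow> real^'d \<Rightarrow> real^'d \<Rightarrow> bool" where
  "is_subgradient f x g \<longleftrightarrow> \<bar>f x\<bar> \<noteq> \<infinity> \<and>
     (\<exists>r::real^'d \<Rightarrow> real. r \<in> o[at x](\<lambda>y. norm (y - x)) \<and>
        (\<forall>\<^sub>F y in at x. f y \<ge> f x + ereal (g \<bullet> (y - x) + r y)))"

section \<open>The Gaussian-approximation condition\<close>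

text \<open>\<open>G\<close> is the chosen subgradient of the potential.\<close>

definition gaussian_approx :: "(real^'d) set \<Rightarrow> (real^'d \<Rightarrow> real) \<Rightarrow> (real^'d \<Rightarrow> real) \<Rightarrow> nat
    \<Rightarrow> real^'d \<Rightarrow> (real^'d \<Rightarrow> real^'d) \<Rightarrow> real^'d^'d \<Rightarrow> real^'d^'d \<Rightarrow> bool" where
  "gaussian_approx \<Theta> prior C n \<theta>hat G I J \<longleftrightarrow>
     spd I \<and> spd J \<and>
     (\<exists>\<epsilon> h M0 R \<epsilon>0 \<epsilon>1 \<rho>1 \<rho>2.
        0 < \<epsilon> \<and> \<epsilon> < 1 \<and> 0 < h \<and> 0 < M0 \<and> 0 \<le> R \<and> 0 \<le> \<epsilon>0 \<and> 0 \<le> \<epsilon>1 \<and> 0 < \<rho>1 \<and> 0 < \<rho>2 \<and>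
        (\<forall>\<xi>. norm (matrix_inv (spd_sqrt I) *v \<xi>) \<le> R \<longrightarrow>
              \<bar>potential \<Theta> prior C n \<theta>hat \<xi> - ereal (1/2 * (\<xi> \<bullet> (J *v \<xi>)))\<bar> \<le> ereal \<epsilon>0 \<and>
              is_subgradient (potential \<Theta> prior C n \<theta>hat) \<xi> (G \<xi>) \<and>
              norm (G \<xi> - J *v \<xi>) \<le> \<epsilon>1) \<and>
        (let Jt = spd_sqrt I ** J ** spd_sqrt I in
          loewner_le (mat \<rho>1) Jt \<and> loewner_le Jt (mat \<rho>2) \<and>
          R \<ge> 8 * sqrt (real CARD('d) / lambda_min Jt)) \<and>
        measure (posterior \<Theta> prior C)
          {\<theta>. sqrt (real n) * norm (matrix_inv (spd_sqrt I) *v (\<theta> - \<theta>hat)) \<le> R / 2}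
        \<ge> 1 - exp (- 4 * \<epsilon>0) * (h * \<rho>1 * \<epsilon>\<^sup>2 / M0\<^sup>2))"

section \<open>Gaussian measures and warm starts\<close>

definition mvn_density :: "real^'d \<Rightarrow> real^'d^'d \<Rightarrow> real^'d \<Rightarrow> real" where
  "mvn_density m S x =
     exp (- (1/2) * ((x - m) \<bullet> (matrix_inv S *v (x - m)))) / sqrt ((2 * pi) ^ CARD('d) * det S)"

definition mvn :: "real^'d \<Rightarrow> real^'d^'d \<Rightarrow> (real^'d) measure" where
  "mvn m S = density lborel (\<lambda>x. ennreal (mvn_density m S x))"

text \<open>The library's \<open>uniform_measure N A\<close>, for arbitrary \<open>N\<close>, is \<open>N\<close> conditioned on \<open>A\<close>;
  it is the zero measure if \<open>N\<close> gives \<open>A\<close> mass \<open>0\<close>.\<close>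

definition warm_init :: "nat \<Rightarrow> real^'d \<Rightarrow> real^'d^'d \<Rightarrow> (real^'d) set \<Rightarrow> (real^'d) measure" where
  "warm_init n \<theta>hat I K =
     uniform_measure (mvn \<theta>hat ((1 / real n) *\<^sub>R I)) {\<theta>. sqrt (real n) *\<^sub>R (\<theta> - \<theta>hat) \<in> K}"

text \<open>\<open>M = \<infinity>\<close> imposes no constraint, also on sets of \<open>\<mu>\<close>-measure \<open>0\<close>, where
  \<open>M * emeasure \<mu> E\<close> alone would be \<open>0\<close> by the convention \<open>\<infinity> * 0 = 0\<close>.\<close>

definition warm :: "ennreal \<Rightarrow> (real^'d) measure \<Rightarrow> (real^'d) measure \<Rightarrow> bool" where
  "warm M \<mu>0 \<mu> \<longleftrightarrow> (\<forall>E \<in> sets borel. M = \<infinity> \<or> emeasure \<mu>0 E \<le> M * emeasure \<mu> E)"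

definition elog :: "ennreal \<Rightarrow> ereal" where
  "elog x = (if x = 0 then -\<infinity> else if x = \<infinity> then \<infinity> else ereal (ln (enn2real x)))"

end

theory Submission
  imports Defs
begin

text \<open>On the set where \<open>\<xi> = sqrt n (\<theta> - \<theta>hat)\<close> lies in \<open>K\<close>, the Gaussian density is proportional to
  \<open>exp (- \<xi> \<bullet> I\<^sup>-\<^sup>1 \<xi> / 2)\<close> and the posterior density to \<open>exp (- V \<xi>)\<close>. The two exponents differ by at
  most \<open>D = B + A / 2\<close>, where \<open>A\<close> and \<open>B\<close> are the two suprema, so up to a constant \<open>k\<close> the densities
  agree within a factor \<open>exp D\<close>. This factor is paid twice, once for the Gaussian mass of the test
  set and once for the normalization of the conditioned Gaussian, while \<open>k\<close> cancels; hence
  \<open>M = exp (2 * D) / p\<close> with \<open>p\<close> the posterior mass of the set. If the right-hand side is infinite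
  (in particular if \<open>p = 0\<close> or \<open>K\<close> is empty), \<open>M = \<infinity>\<close> will do.\<close>

section \<open>Inverses of positive definite and scaled matrices\<close>

text \<open>A kernel vector \<open>v\<close> satisfies \<open>v \<bullet> (A *v v) = 0\<close>, so
  definiteness forces \<open>v = 0\<close>.\<close>

lemma spd_imp_invertible:
  assumes "spd A"
  shows "invertible A"
  unfolding invertible_left_inverse matrix_left_invertible_ker
  using assms by (metis inner_zero_right less_irrefl spd_def)

lemma matrix_inv_inverse:
  fixes A :: "'a::semiring_1^'n^'m"
  assumes "invertible A"
  shows "A ** matrix_inv A = mat 1" "matrix_inv A ** A = mat 1"
  using someI_ex[OF assms[unfolded invertible_def]] by (simp_all add: matrix_inv_def)

lemma matrix_inv_eqI:
  fixes A :: "'a::semiring_1^'n^'m"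
  assumes "A ** B = mat 1" "B ** A = mat 1"
  shows "matrix_inv A = B"
proof -
  have "invertible A" using assms unfolding invertible_def by blast
  then have "matrix_inv A ** (A ** B) = B"
    by (simp add: matrix_mul_assoc matrix_inv_inverse)
  then show ?thesis by (simp add: assms)
qed

lemma matrix_inv_scaleR:
  fixes A :: "real^'d^'d"
  assumes "invertible A" "c \<noteq> 0"
  shows "matrix_inv (c *\<^sub>R A) = inverse c *\<^sub>R matrix_inv A"
  using assms
  by (intro matrix_inv_eqI)
    (simp_all add: matrix_scalar_ac matrix_inv_inverse flip: scalar_matrix_assoc)

section \<open>Conditioning under two-sided density bounds\<close>

text \<open>In the application \<open>x\<close> and \<open>m\<close> are Gaussian masses of the test
  set and of the conditioning set, \<open>y\<close> and \<open>p\<close> the posterior masses.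
  Multiplying the first bound by \<open>p\<close> and inserting the second gives
  \<open>x * p \<le> t\<^sup>2 * m * y\<close>; the second also forces \<open>m > 0\<close>.\<close>

lemma ennreal_div_le_of_two_sided:
  fixes x y m p k t :: ennreal
  assumes "x \<le> t * (k * y)" "k * p \<le> t * m"
    and "0 < p" "p < \<infinity>" "0 < k" "k < \<infinity>" "0 < t" "t < \<infinity>"
  shows "x / m \<le> t\<^sup>2 / p * y"
proof (cases "m = \<infinity> \<or> y = \<infinity>")
  \<comment> \<open>\<open>m = \<infinity>\<close> makes the left side 0;
    \<open>y = \<infinity>\<close> makes the right side infinite, as \<open>t\<^sup>2 / p\<close> is
    positive.\<close>
  case True
  then show ?thesis
    using assms by (auto simp: ennreal_mult_top)
next
  case False
  obtain p' k' t' where r: "p = ennreal p'" "k = ennreal k'" "t = ennreal t'"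
    and pos: "0 < p'" "0 < k'" "0 < t'"
    using assms(3-) by (cases p; cases k; cases t) auto
  obtain m' y' where r': "m = ennreal m'" "y = ennreal y'" and nn: "0 \<le> m'" "0 \<le> y'"
    using False by (cases m; cases y) auto
  have x: "x \<le> ennreal (t' * (k' * y'))"
    using assms(1) pos nn by (simp add: r r' ennreal_mult)
  then obtain x' where rx: "x = ennreal x'" and nx: "0 \<le> x'"
    by (cases x) (auto simp: top_unique)
  have ux: "x' \<le> t' * (k' * y')"
    using x pos nn by (simp add: rx)
  have lm: "k' * p' \<le> t' * m'"
    using assms(2) pos nn by (simp add: r r' flip: ennreal_mult)
  then have m: "0 < m'"
    using pos nn by (smt (verit) mult_pos_pos mult_eq_0_iff)
  have "x' * p' \<le> t' * (k' * y') * p'"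
    using ux pos by (intro mult_right_mono) auto
  also have "\<dots> = t' * y' * (k' * p')" by simp
  also have "\<dots> \<le> t' * y' * (t' * m')"
    using lm pos nn by (intro mult_left_mono) auto
  finally have "x' / m' \<le> t'\<^sup>2 / p' * y'"
    using m pos by (simp add: field_simps power2_eq_square)
  then show ?thesis
    using m pos nn nx
    by (simp add: r r' rx divide_ennreal ennreal_power flip: ennreal_mult)
qed

text \<open>Comparability on \<open>S\<close> suffices because conditioning sees only
  \<open>S \<inter> E\<close>. Integrating \<open>upper\<close> there and then enlarging to
  \<open>E\<close> bounds the numerator; integrating \<open>lower\<close> over \<open>S\<close>
  bounds the normalization.\<close>

lemma emeasure_uniform_measure_density_le:
  assumes [measurable]: "f \<in> borel_measurable N" "g \<in> borel_measurable N"
      "S \<in> sets N" "E \<in> sets N"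
    and upper: "\<And>x. x \<in> S \<Longrightarrow> g x \<le> t * (k * f x)"
    and lower: "\<And>x. x \<in> S \<Longrightarrow> k * f x \<le> t * g x"
    and pos: "0 < emeasure (density N f) S" "emeasure (density N f) S < \<infinity>"
    and k: "0 < k" "k < \<infinity>" and t: "0 < t" "t < \<infinity>"
  shows "emeasure (uniform_measure (density N g) S) E
    \<le> t\<^sup>2 / emeasure (density N f) S * emeasure (density N f) E"
proof -
  have "emeasure (density N g) (S \<inter> E) \<le> (\<integral>\<^sup>+x. t * (k * (f x * indicator E x)) \<partial>N)"
    by (subst emeasure_density)
      (auto intro!: nn_integral_mono split: split_indicator simp: upper)
  also have "\<dots> = t * (k * emeasure (density N f) E)"
    by (simp add: nn_integral_cmult emeasure_density)
  finally have up: "emeasure (density N g) (S \<inter> E) \<le> t * (k * emeasure (density N f) E)" .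
  have "k * emeasure (density N f) S = (\<integral>\<^sup>+x. k * (f x * indicator S x) \<partial>N)"
    by (simp add: nn_integral_cmult emeasure_density)
  also have "\<dots> \<le> (\<integral>\<^sup>+x. t * (g x * indicator S x) \<partial>N)"
    by (auto intro!: nn_integral_mono split: split_indicator simp: lower)
  also have "\<dots> = t * emeasure (density N g) S"
    by (simp add: nn_integral_cmult emeasure_density)
  finally have lo: "k * emeasure (density N f) S \<le> t * emeasure (density N g) S" .
  show ?thesis
    using ennreal_div_le_of_two_sided[OF up lo pos k t] by simp
qed

section \<open>Measurability and normalization of the posterior\<close>

lemma borel_measurable_posterior_unnorm:
  assumes [measurable]: "\<Theta> \<in> sets borel"
    and "prior \<in> borel_measurable (restrict_space borel \<Theta>)"
    and "C \<in> borel_measurable (restrict_space borel \<Theta>)"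
  shows "posterior_unnorm \<Theta> prior C \<in> borel_measurable borel"
proof -
  have "(\<lambda>\<theta>. ennreal (prior \<theta> * exp (C \<theta>))) \<in> borel_measurable (restrict_space borel \<Theta>)"
    using assms(2,3) by measurable
  then have "(\<lambda>\<theta>. ennreal (prior \<theta> * exp (C \<theta>)) * indicator \<Theta> \<theta>) \<in> borel_measurable borel"
    by (subst (asm) borel_measurable_restrict_space_iff_ennreal) auto
  moreover have "posterior_unnorm \<Theta> prior C = (\<lambda>\<theta>. ennreal (prior \<theta> * exp (C \<theta>)) * indicator \<Theta> \<theta>)"
    by (auto simp: posterior_unnorm_def split: split_indicator)
  ultimately show ?thesis by simp
qed

text \<open>The total mass is \<open>?Z / ?Z\<close>, which in \<open>ennreal\<close> equals 0 when
  \<open>?Z\<close> is 0 or \<infinity>; mass 1 excludes both.\<close>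

lemma posterior_normalizer:
  assumes [measurable]: "posterior_unnorm \<Theta> prior C \<in> borel_measurable borel"
    and "prob_space (posterior \<Theta> prior C)"
  shows "0 < (\<integral>\<^sup>+t. posterior_unnorm \<Theta> prior C t \<partial>lborel)"
    and "(\<integral>\<^sup>+t. posterior_unnorm \<Theta> prior C t \<partial>lborel) < \<infinity>"
proof -
  let ?Z = "\<integral>\<^sup>+t. posterior_unnorm \<Theta> prior C t \<partial>lborel"
  have "(\<integral>\<^sup>+t. posterior_unnorm \<Theta> prior C t / ?Z \<partial>lborel) = 1"
    using prob_space.emeasure_space_1[OF assms(2)]
    by (simp add: posterior_def emeasure_density)
  then have Z: "?Z / ?Z = 1"
    by (simp add: nn_integral_divide)
  show "0 < ?Z" "?Z < \<infinity>"
    using Z by (auto simp: top.not_eq_extremum[symmetric] zero_less_iff_neq_zero)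
qed

section \<open>Gaussian density and potential in the rescaled variable\<close>

lemma quad_form_diff:
  "\<xi> \<bullet> ((A - B) *v \<xi>) = \<xi> \<bullet> (A *v \<xi>) - \<xi> \<bullet> (B *v (\<xi>::real^'d))"
  by (simp add: matrix_vector_mult_diff_rdistrib inner_diff_right)

text \<open>Inverting the scaled covariance produces a factor \<open>n\<close>, split as
  \<open>sqrt n\<close> on each side of the quadratic form. The constant \<open>c\<close> stays
  unevaluated.\<close>

lemma mvn_density_scaled:
  fixes S :: "real^'d^'d"
  assumes "spd S" "n \<ge> 1"
  defines "c \<equiv> 1 / sqrt ((2 * pi) ^ CARD('d) * det ((1 / real n) *\<^sub>R S))"
  shows "mvn_density m ((1 / real n) *\<^sub>R S) \<theta>
    = c * exp (- (1/2) * ((sqrt (real n) *\<^sub>R (\<theta> - m)) \<bullet> (matrix_inv S *v (sqrt (real n) *\<^sub>R (\<theta> - m)))))"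
proof -
  have "matrix_inv ((1 / real n) *\<^sub>R S) = real n *\<^sub>R matrix_inv S"
    using matrix_inv_scaleR[OF spd_imp_invertible[OF assms(1)], of "1 / real n"] assms(2) by simp
  then show ?thesis
    by (simp add: mvn_density_def c_def matrix_scaleR_vector_ac flip: scaleR_matrix_vector_assoc)
qed

lemma borel_measurable_mvn_density [measurable]: "mvn_density m S \<in> borel_measurable borel"
proof -
  have "continuous_on UNIV (\<lambda>x. exp (- (1/2) * ((x - m) \<bullet> (matrix_inv S *v (x - m)))))"
    by (intro continuous_intros
        continuous_on_compose2[OF matrix_vector_mult_linear_continuous_on[of UNIV]]) auto
  then have "(\<lambda>x. exp (- (1/2) * ((x - m) \<bullet> (matrix_inv S *v (x - m))))) \<in> borel_measurable borel"
    by (rule borel_measurable_continuous_onI)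
  then show ?thesis
    unfolding mvn_density_def[abs_def] by (rule borel_measurable_divide) simp
qed

text \<open>A finite potential puts the point in \<open>\<Theta>\<close> with positive prior, so the
  logarithms can be undone by \<open>exp\<close>.\<close>

lemma posterior_unnorm_eq_potential:
  assumes "potential \<Theta> prior C n \<theta>hat \<xi> = ereal v" "0 < prior \<theta>hat"
  shows "posterior_unnorm \<Theta> prior C (\<theta>hat + \<xi> /\<^sub>R sqrt (real n))
    = ennreal (prior \<theta>hat * exp (C \<theta>hat) * exp (- v))"
proof -
  define \<theta> where "\<theta> = \<theta>hat + \<xi> /\<^sub>R sqrt (real n)"
  have *: "\<theta> \<in> \<Theta>" "0 < prior \<theta>" "v = - C \<theta> + C \<theta>hat - ln (prior \<theta>) + ln (prior \<theta>hat)"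
    using assms(1) by (auto simp: potential_def Let_def \<theta>_def split: if_splits)
  have "- v = (C \<theta> + ln (prior \<theta>)) - (C \<theta>hat + ln (prior \<theta>hat))"
    using *(3) by simp
  then have "exp (- v) = exp (C \<theta>) * prior \<theta> / (exp (C \<theta>hat) * prior \<theta>hat)"
    using *(2) assms(2) by (simp only: exp_add exp_diff exp_ln)
  then show ?thesis
    using * assms(2) by (simp add: posterior_unnorm_def \<theta>_def[symmetric])
qed

text \<open>Over an empty \<open>K\<close> the supremum would be -\<infinity>; one nonnegative term
  rules this out.\<close>

lemma SUP_nonneg_finiteE:
  fixes f :: "'a \<Rightarrow> ereal"
  assumes "K \<noteq> {}" "\<And>x. x \<in> K \<Longrightarrow> 0 \<le> f x" "(SUP x\<in>K. f x) \<noteq> \<infinity>"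
  obtains b where "(SUP x\<in>K. f x) = ereal b" "\<And>x. x \<in> K \<Longrightarrow> f x \<le> ereal b"
proof -
  obtain x0 where "x0 \<in> K" using assms(1) by blast
  then have "0 \<le> (SUP x\<in>K. f x)" using assms(2) by (meson SUP_upper2)
  then obtain b where b: "(SUP x\<in>K. f x) = ereal b"
    using assms(3) by (cases "SUP x\<in>K. f x") auto
  show thesis
    by (rule that[OF b]) (metis SUP_upper b)
qed

section \<open>The warm-start bound\<close>

theorem lemma2:
  fixes \<Theta> :: "(real^'d) set"
    and prior C :: "real^'d \<Rightarrow> real"
    and n :: nat
    and \<theta>hat :: "real^'d"
    and G :: "real^'d \<Rightarrow> real^'d"
    and Itil J :: "real^'d^'d"
    and K :: "(real^'d) set"
  assumes "n \<ge> 1"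
    and "\<Theta> \<in> sets borel"
    and "prior \<in> borel_measurable (restrict_space borel \<Theta>)"
    and "\<And>\<theta>. \<theta> \<in> \<Theta> \<Longrightarrow> 0 \<le> prior \<theta>"
    and "(\<integral>\<^sup>+\<theta>\<in>\<Theta>. ennreal (prior \<theta>) \<partial>lborel) = 1"
    and "C \<in> borel_measurable (restrict_space borel \<Theta>)"
    and "prob_space (posterior \<Theta> prior C)"
    and "is_arg_max C (\<lambda>\<theta>. \<theta> \<in> \<Theta>) \<theta>hat"
    and "0 < prior \<theta>hat"
    and "gaussian_approx \<Theta> prior C n \<theta>hat G Itil J"
    and "compact K"
  shows "\<exists>M. warm M (warm_init n \<theta>hat Itil K) (posterior \<Theta> prior C) \<and>
    elog M \<le> - elog (emeasure (posterior \<Theta> prior C) {\<theta>. sqrt (real n) *\<^sub>R (\<theta> - \<theta>hat) \<in> K})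
      + (SUP \<xi>\<in>K. ereal \<bar>\<xi> \<bullet> ((matrix_inv Itil - J) *v \<xi>)\<bar>)
      + 2 * (SUP \<xi>\<in>K. \<bar>potential \<Theta> prior C n \<theta>hat \<xi> - ereal (1/2 * (\<xi> \<bullet> (J *v \<xi>)))\<bar>)"
    (is "\<exists>M. _ \<and> _ \<le> - elog ?p + ?SA + 2 * ?SB")
proof (cases "- elog ?p + ?SA + 2 * ?SB = \<infinity>")
  case True
  then show ?thesis
    by (intro exI[of _ \<infinity>]) (simp only: True warm_def, simp)
next
  case False
  interpret P: prob_space "posterior \<Theta> prior C" by fact
  let ?V = "potential \<Theta> prior C n \<theta>hat"
  define S where "S = {\<theta>. sqrt (real n) *\<^sub>R (\<theta> - \<theta>hat) \<in> K}"
  define Z where "Z = (\<integral>\<^sup>+t. posterior_unnorm \<Theta> prior C t \<partial>lborel)"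
  define q where "q = (\<lambda>\<theta>. posterior_unnorm \<Theta> prior C \<theta> / Z)"
  define g where "g = mvn_density \<theta>hat ((1 / real n) *\<^sub>R Itil)"
  have I: "spd Itil" using assms(10) by (simp add: gaussian_approx_def)
  have u_meas [measurable]: "posterior_unnorm \<Theta> prior C \<in> borel_measurable borel"
    using assms by (intro borel_measurable_posterior_unnorm)
  have [measurable]: "q \<in> borel_measurable lborel" "g \<in> borel_measurable borel"
    by (simp_all add: q_def g_def)
  \<comment> \<open>Compactness of \<open>K\<close> enters here: its preimage is closed, hence
    Borel.\<close>
  have S_meas [measurable]: "S \<in> sets borel"
  proof -
    have "closed ((\<lambda>\<theta>. sqrt (real n) *\<^sub>R (\<theta> - \<theta>hat)) -` K)"
      by (intro closed_vimage compact_imp_closed assms continuous_intros)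
    then show ?thesis by (auto simp: S_def vimage_def)
  qed
  have post: "posterior \<Theta> prior C = density lborel q"
    by (simp add: posterior_def q_def Z_def)
  have Z: "0 < Z" "Z < \<infinity>"
    using posterior_normalizer[OF u_meas assms(7)] by (simp_all add: Z_def)
  obtain Zr where Zr: "Z = ennreal Zr" "0 < Zr"
    using Z by (cases Z) auto
  \<comment> \<open>\<open>- elog 0\<close> is \<infinity>, and in \<open>ereal\<close> adding
    -\<infinity> to it still gives \<infinity>, so this holds even before \<open>K\<close> is known
    to be nonempty.\<close>
  have p: "?p \<noteq> 0"
    using False by (auto simp: elog_def)
  obtain \<xi>0 where \<xi>0: "\<xi>0 \<in> K" using p by fastforce
  then have K: "K \<noteq> {}" by auto
  have nonneg: "0 \<le> ?SA" "0 \<le> ?SB"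
    by (rule SUP_upper2[OF \<xi>0], simp)+
  have fin: "?SA \<noteq> \<infinity>" "?SB \<noteq> \<infinity>"
    using False nonneg by auto
  obtain A where A: "?SA = ereal A"
    and A_ge: "\<And>\<xi>. \<xi> \<in> K \<Longrightarrow> ereal \<bar>\<xi> \<bullet> ((matrix_inv Itil - J) *v \<xi>)\<bar> \<le> ereal A"
    by (rule SUP_nonneg_finiteE[OF K _ fin(1)]) auto
  obtain B where B: "?SB = ereal B"
    and B_ge: "\<And>\<xi>. \<xi> \<in> K \<Longrightarrow> \<bar>?V \<xi> - ereal (1/2 * (\<xi> \<bullet> (J *v \<xi>)))\<bar> \<le> ereal B"
    by (rule SUP_nonneg_finiteE[OF K _ fin(2)]) auto
  obtain pr where pr: "?p = ennreal pr" "0 < pr"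
    using p P.emeasure_finite by (cases ?p) auto
  \<comment> \<open>The exponents carry half the quadratic forms, hence \<open>A / 2\<close>;
    doubling \<open>D\<close> gives the weights \<open>A + 2 * B\<close> of the claim.\<close>
  define D where "D = B + A / 2"
  define M where "M = ennreal ((exp D)\<^sup>2 / pr)"
  define c where "c = 1 / sqrt ((2 * pi) ^ CARD('d) * det ((1 / real n) *\<^sub>R Itil))"
  define u0 where "u0 = prior \<theta>hat * exp (C \<theta>hat)"
  have u0: "0 < u0" using assms(9) by (simp add: u0_def)
  have D2: "(exp D)\<^sup>2 = exp (A + 2 * B)"
    by (simp add: D_def power2_eq_square algebra_simps flip: exp_add)

  \<comment> \<open>Keeping \<open>c\<close> apart from \<open>w\<close> makes the comparison
    independent of the sign of \<open>c\<close>.\<close>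
  have main: "\<exists>v w. q \<theta> = ennreal (u0 / Zr * exp (- v)) \<and> g \<theta> = c * w \<and> 0 \<le> w \<and>
      exp (- v) \<le> exp D * w \<and> w \<le> exp D * exp (- v)"
    if "\<theta> \<in> S" for \<theta>
  proof -
    define \<xi> where "\<xi> = sqrt (real n) *\<^sub>R (\<theta> - \<theta>hat)"
    have \<xi>: "\<xi> \<in> K" using that by (simp add: S_def \<xi>_def)
    have \<theta>: "\<theta> = \<theta>hat + \<xi> /\<^sub>R sqrt (real n)"
      using assms(1) by (simp add: \<xi>_def)
    define w where "w = exp (- (1/2) * (\<xi> \<bullet> (matrix_inv Itil *v \<xi>)))"
    \<comment> \<open>A real bound on the deviation from a real number forces the potential to be
      finite.\<close>
    obtain v where v: "?V \<xi> = ereal v"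
      using B_ge[OF \<xi>] by (cases "?V \<xi>") auto
    have q: "q \<theta> = ennreal (u0 / Zr * exp (- v))"
      using posterior_unnorm_eq_potential[OF v assms(9)] Zr u0
      by (simp add: q_def \<theta> u0_def divide_ennreal)
    have vB: "\<bar>v - 1/2 * (\<xi> \<bullet> (J *v \<xi>))\<bar> \<le> B"
      using B_ge[OF \<xi>] by (simp add: v)
    have "\<bar>\<xi> \<bullet> (matrix_inv Itil *v \<xi>) - \<xi> \<bullet> (J *v \<xi>)\<bar> \<le> A"
      using A_ge[OF \<xi>] by (simp add: quad_form_diff)
    \<comment> \<open>Triangle inequality through
      \<open>1/2 * (\<xi> \<bullet> (J *v \<xi>))\<close>.\<close>
    with vB have "\<bar>v - 1/2 * (\<xi> \<bullet> (matrix_inv Itil *v \<xi>))\<bar> \<le> D"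
      unfolding D_def abs_le_iff by linarith
    then have "exp (- v) \<le> exp D * w" "w \<le> exp D * exp (- v)"
      unfolding w_def by (simp_all add: abs_le_iff flip: exp_add)
    moreover have "g \<theta> = c * w"
      unfolding g_def c_def w_def \<xi>_def by (rule mvn_density_scaled[OF I assms(1)])
    moreover have "0 \<le> w" by (simp add: w_def)
    ultimately show ?thesis using q by blast
  qed

  have "emeasure (warm_init n \<theta>hat Itil K) E \<le> M * emeasure (posterior \<Theta> prior C) E"
    if E [measurable]: "E \<in> sets borel" for E
  proof (cases "0 < c")
    case True
    \<comment> \<open>The ratio of the prefactors \<open>c\<close> and \<open>u0 / Zr\<close>, so
      that \<open>k * q \<theta>\<close> becomes \<open>c * exp (- v)\<close>.\<close>
    define k where "k = c * Zr / u0"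
    have k: "0 < k" using True Zr u0 by (simp add: k_def)
    have bounds: "ennreal (g \<theta>) \<le> ennreal (exp D) * (ennreal k * q \<theta>)"
      "ennreal k * q \<theta> \<le> ennreal (exp D) * ennreal (g \<theta>)" if \<theta>: "\<theta> \<in> S" for \<theta>
    proof -
      obtain v w where vw: "q \<theta> = ennreal (u0 / Zr * exp (- v))" "exp (- v) \<le> exp D * w"
        "w \<le> exp D * exp (- v)" "g \<theta> = c * w"
        using main[OF \<theta>] by blast
      have "ennreal k * q \<theta> = ennreal (c * exp (- v))"
        using k u0 Zr vw(1) by (simp add: k_def flip: ennreal_mult)
      then show "ennreal (g \<theta>) \<le> ennreal (exp D) * (ennreal k * q \<theta>)"
        "ennreal k * q \<theta> \<le> ennreal (exp D) * ennreal (g \<theta>)"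
        using True vw by (auto simp: mult.left_commute[of "exp D"] simp flip: ennreal_mult'
            intro!: ennreal_leI mult_left_mono)
    qed
    have "emeasure (uniform_measure (density lborel (\<lambda>x. ennreal (g x))) S) E
      \<le> (ennreal (exp D))\<^sup>2 / emeasure (density lborel q) S * emeasure (density lborel q) E"
      using pr k
      by (intro emeasure_uniform_measure_density_le[where k = "ennreal k"] bounds)
        (auto simp: post S_def[symmetric])
    then show ?thesis
      using pr by (simp add: warm_init_def mvn_def g_def S_def[symmetric] post M_def
          divide_ennreal ennreal_power)
  next
    case False
    \<comment> \<open>Impossible, as \<open>det Itil > 0\<close>; but the Gaussian would then be the zero measure, which spares
      us the positivity of the determinant.\<close>
    have "ennreal (g \<theta>) * indicator (S \<inter> E) \<theta> = 0" for \<theta>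
    proof (cases "\<theta> \<in> S")
      case True
      then show ?thesis
        using main[OF True] False
        by (auto simp: ennreal_eq_0_iff mult_nonpos_nonneg)
    qed simp
    then have "emeasure (density lborel (\<lambda>x. ennreal (g x))) (S \<inter> E) = 0"
      by (subst emeasure_density) (measurable, simp only: nn_integral_const mult_zero_left)
    then show ?thesis
      by (simp add: warm_init_def mvn_def g_def S_def[symmetric])
  qed
  then have "warm M (warm_init n \<theta>hat Itil K) (posterior \<Theta> prior C)"
    by (simp add: warm_def)
  \<comment> \<open>This choice of \<open>M\<close> attains the bound with equality.\<close>
  moreover have "elog M = - elog ?p + ?SA + 2 * ?SB"
    unfolding A B using pr by (simp add: M_def elog_def D2 ln_div)
  ultimately show ?thesis by auto
qed

end
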